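(* Let $\mathcal X\subseteq\mathbb R^n$ be closed and let $\mathcal H$ be a properly loosely constrained hypothesis on $\mathcal X$, with tight constraint $\Phi':\mathcal X\to\mathbb R^{m'}$ and slack constraint $\Phi'':\mathcal X\to\mathbb R^{m''}$. Define $$\tilde\Lambda_{\Phi',\Phi''}=\big\{(\lambda',\lambda'')\;:\;\lambda'\in\mathbb R^{m'},\ \lambda''\in[0,+\infty)^{m''},\ 1-\lambda'\cdot\Phi'(x)-\lambda''\cdot\Phi''(x)\ge 0\ \ \forall x\in\mathcal X\big\}.$$ Then the optimal e-class for $\mathcal H$ exists and coincides with $$\tilde{\mathcal E}_{\mathcal H}^\vee=\big\{1-\lambda'\cdot\Phi'-\lambda''\cdot\Phi''\;:\;(\lambda',\lambda'')\in\tilde\Lambda_{\Phi',\Phi''}\big\}.$$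
   Context: $\mathcal P_{\mathcal X}$ denotes the set of Borel probability measures on the closed set $\mathcal X\subseteq\mathbb R^n$, and $\langle P,f\rangle$ the expectation of $f$ under $P$. A hypothesis on $\mathcal X$ is a non-empty subset $\mathcal H\subseteq\mathcal P_{\mathcal X}$. An e-variable for $\mathcal H$ is a Borel function $E:\mathcal X\to[0,+\infty)$ with $\langle P,E\rangle\le 1$ for all $P\in\mathcal H$; $\mathcal E_{\mathcal H}$ is the set of all e-variables, and an e-class is a subset of $\mathcal E_{\mathcal H}$. For real functions on $\mathcal X$, $f\succeq f'$ means $f(x)\ge f'(x)$ for all $x\in\mathcal X$. An e-class $\mathcal E\subseteq\mathcal E_{\mathcal H}$ is majorising if for every $E\in\mathcal E_{\mathcal H}$ there is $E'\in\mathcal E$ with $E'\succeq E$. A majorising e-class contained in every other majorising e-class is called optimal (if it exists, it is unique). For Borel $\Psi:\mathcal X\to\mathbb R^m$, $\mathcal P_\Psi=\{P\in\mathcal P_{\mathcal X}:\langle P,\|\Psi\|_1\rangle<+\infty\}$. A hypothesis $\mathcal H$ on $\mathcal X$ is loosely constrained if there are continuous functions $\Phi':\mathcal X\to\mathbb R^{m'}$ (tight constraint) and $\Phi'':\mathcal X\to\mathbb R^{m''}$ (slack constraint) such that, with $\Phi=(\Phi',\Phi''):\mathcal X\to\mathbb R^{m'+m''}$, one has $0\in\mathrm{conv}\,\Phi(\mathcal X)$ and $$\mathcal H=\{P\in\mathcal P_{\Phi'}\cap\mathcal P_{\Phi''}\;:\;\langle P,\Phi'\rangle=0,\ \langle P,\Phi''\rangle\ge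 0\}$$ (the inequality being component-wise). If moreover $0\in\mathrm{rel\,int}(\mathrm{conv}\,\Phi(\mathcal X))$, then $\mathcal H$ is said to be properly loosely constrained, with tight and slack constraints $\Phi',\Phi''$. *)

theory Defs
  imports "HOL-Probability.Probability"
begin

(* Functions on X are represented by HOL functions that are undefined outside X, so that
   equality of HOL functions is equality of functions on X and sets of functions on X
   (e-classes) can be compared by inclusion.  A constraint, in contrast, is any total
   function of which only the values on X are used.

   A vector type has at least one component.  The case of zero tight (or zero slack)
   components is covered by taking the constant function 0 as the tight (or slack)
   constraint: this leaves the hypothesis, the condition that 0 lies in the (relative
   interior of the) convex hull, and the functions below unchanged. *)

definition borel_probs :: "(real ^ 'n) set \<Rightarrow> (real ^ 'n) measure set" where
  "borel_probs X = {P. prob_space P \<and> sets P = sets (restrict_space borel X)}"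

definition hypothesis :: "(real ^ 'n) set \<Rightarrow> (real ^ 'n) measure set \<Rightarrow> bool" where
  "hypothesis X H \<longleftrightarrow> H \<noteq> {} \<and> H \<subseteq> borel_probs X"

(* The expectation of a nonnegative function is taken in [0, \<infinity>]; the Bochner integral
   would return 0 for a function with infinite expectation. *)

definition e_variables ::
  "(real ^ 'n) set \<Rightarrow> (real ^ 'n) measure set \<Rightarrow> (real ^ 'n \<Rightarrow> real) set" where
  "e_variables X H =
     {E. E \<in> X \<rightarrow>\<^sub>E {0..} \<and> E \<in> borel_measurable (restrict_space borel X) \<and>
         (\<forall>P\<in>H. (\<integral>\<^sup>+ x. ennreal (E x) \<partial>P) \<le> 1)}"

definition majorising ::
  "(real ^ 'n) set \<Rightarrow> (real ^ 'n) measure set \<Rightarrow> (real ^ 'n \<Rightarrow> real) set \<Rightarrow> bool" where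
  "majorising X H \<E> \<longleftrightarrow>
     \<E> \<subseteq> e_variables X H \<and>
     (\<forall>E\<in>e_variables X H. \<exists>E'\<in>\<E>. \<forall>x\<in>X. E' x \<ge> E x)"

definition optimal_e_class ::
  "(real ^ 'n) set \<Rightarrow> (real ^ 'n) measure set \<Rightarrow> (real ^ 'n \<Rightarrow> real) set \<Rightarrow> bool" where
  "optimal_e_class X H \<E> \<longleftrightarrow>
     majorising X H \<E> \<and> (\<forall>\<F>. majorising X H \<F> \<longrightarrow> \<E> \<subseteq> \<F>)"

lemma optimal_e_class_unique:
  assumes "optimal_e_class X H \<E>" and "optimal_e_class X H \<F>"
  shows "\<E> = \<F>"
  using assms unfolding optimal_e_class_def by blast

definition l1_norm :: "real ^ 'm \<Rightarrow> real" where
  "l1_norm v = (\<Sum>i\<in>UNIV. \<bar>v $ i\<bar>)"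

definition probs_integrating ::
  "(real ^ 'n) set \<Rightarrow> (real ^ 'n \<Rightarrow> real ^ 'm) \<Rightarrow> (real ^ 'n) measure set" where
  "probs_integrating X \<Psi> =
     {P \<in> borel_probs X. (\<integral>\<^sup>+ x. ennreal (l1_norm (\<Psi> x)) \<partial>P) < \<infinity>}"

definition loosely_constrained ::
  "(real ^ 'n) set \<Rightarrow> (real ^ 'n) measure set \<Rightarrow>
   (real ^ 'n \<Rightarrow> real ^ 'k) \<Rightarrow> (real ^ 'n \<Rightarrow> real ^ 'l) \<Rightarrow> bool" where
  "loosely_constrained X H \<Phi>' \<Phi>'' \<longleftrightarrow>
     hypothesis X H \<and>
     continuous_on X \<Phi>' \<and> continuous_on X \<Phi>'' \<and>
     0 \<in> convex hull ((\<lambda>x. (\<Phi>' x, \<Phi>'' x)) ` X) \<and>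
     H = {P \<in> probs_integrating X \<Phi>' \<inter> probs_integrating X \<Phi>''.
            (\<integral>x. \<Phi>' x \<partial>P) = 0 \<and> (\<forall>i. (\<integral>x. \<Phi>'' x \<partial>P) $ i \<ge> 0)}"

definition properly_loosely_constrained ::
  "(real ^ 'n) set \<Rightarrow> (real ^ 'n) measure set \<Rightarrow>
   (real ^ 'n \<Rightarrow> real ^ 'k) \<Rightarrow> (real ^ 'n \<Rightarrow> real ^ 'l) \<Rightarrow> bool" where
  "properly_loosely_constrained X H \<Phi>' \<Phi>'' \<longleftrightarrow>
     loosely_constrained X H \<Phi>' \<Phi>'' \<and>
     0 \<in> rel_interior (convex hull ((\<lambda>x. (\<Phi>' x, \<Phi>'' x)) ` X))"

definition dual_set ::
  "(real ^ 'n) set \<Rightarrow> (real ^ 'n \<Rightarrow> real ^ 'k) \<Rightarrow> (real ^ 'n \<Rightarrow> real ^ 'l) \<Rightarrow>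
   ((real ^ 'k) \<times> (real ^ 'l)) set" where
  "dual_set X \<Phi>' \<Phi>'' =
     {(\<mu>', \<mu>''). (\<forall>i. \<mu>'' $ i \<ge> 0) \<and>
                (\<forall>x\<in>X. 1 - \<mu>' \<bullet> \<Phi>' x - \<mu>'' \<bullet> \<Phi>'' x \<ge> 0)}"

definition dual_e_class ::
  "(real ^ 'n) set \<Rightarrow> (real ^ 'n \<Rightarrow> real ^ 'k) \<Rightarrow> (real ^ 'n \<Rightarrow> real ^ 'l) \<Rightarrow>
   (real ^ 'n \<Rightarrow> real) set" where
  "dual_e_class X \<Phi>' \<Phi>'' =
     (\<lambda>(\<mu>', \<mu>''). restrict (\<lambda>x. 1 - \<mu>' \<bullet> \<Phi>' x - \<mu>'' \<bullet> \<Phi>'' x) X) ` dual_set X \<Phi>' \<Phi>''"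

end

(* An e-variable E satisfies r \<le> 1 for every point ((0, v), r) with v \<ge> 0 of the convex hull of
   the graph of (\<Phi>, E), because a convex combination of points of this graph is the expectation
   under a finitely supported probability measure.  Separating this convex hull from the half line
   above (0, 1) gives an affine majorant 1 - c \<bullet> \<Phi> of E, where relative interiority of 0 in the
   convex hull of \<Phi>(X) excludes a vertical hyperplane.  Slater's condition may fail for the slack
   constraints (only relative interiority is given), so the separation is carried out inside
   L = span \<Phi>(X); the functional c is then nonnegative only on the part of the constraint cone in L,
   and Farkas' lemma replaces it by one with the right signs that agrees with c on L.  Finally,
   comparable functions of the form 1 - c \<bullet> \<Phi> are equal: their difference is linear in \<Phi>,
   nonnegative, and vanishes at the relative interior point 0.  So all of them are maximal. *)

theory Submission
  imports Defs
begin

section \<open>Convex hulls, relative interiors and cones\<close>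

text \<open>An injective choice of preimages moves the weights from values of \<open>f\<close> to
  points of \<open>X\<close>, where they can later serve as the masses of a measure.\<close>

lemma convex_hull_imageE:
  fixes f :: "'a \<Rightarrow> 'b::real_vector"
  assumes "y \<in> convex hull (f ` X)"
  obtains S u where "finite S" "S \<subseteq> X" "\<And>x. x \<in> S \<Longrightarrow> 0 \<le> u x" "sum u S = (1::real)"
    "(\<Sum>x\<in>S. u x *\<^sub>R f x) = y"
proof -
  obtain T v where T: "finite T" "T \<subseteq> f ` X" "\<forall>z\<in>T. 0 \<le> v z" "sum v T = (1::real)"
      "(\<Sum>z\<in>T. v z *\<^sub>R z) = y"
    using assms unfolding convex_hull_explicit by blast
  obtain S where S: "S \<subseteq> X" "inj_on f S" "T = f ` S"
    using T(2) unfolding subset_image_inj by blast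
  show thesis
  proof (rule that[of S "v \<circ> f"])
    show "finite S"
      using T(1) S by (metis finite_imageD)
    show "sum (v \<circ> f) S = 1" "(\<Sum>x\<in>S. (v \<circ> f) x *\<^sub>R f x) = y"
      using T(4,5) S by (auto simp: sum.reindex)
  qed (use T S in auto)
qed

text \<open>From any \<open>a\<close> in \<open>C\<close> the segment through 0 can be prolonged
  inside \<open>C\<close> to a negative multiple of \<open>a\<close>, which forces the opposite
  sign.\<close>

lemma inner_eq_0_if_0_in_rel_interior:
  fixes C :: "'a::euclidean_space set"
  assumes "convex C" and 0: "0 \<in> rel_interior C" and nonneg: "\<And>a. a \<in> C \<Longrightarrow> 0 \<le> c \<bullet> a"
    and "a \<in> C"
  shows "c \<bullet> a = 0"
proof -
  have "C \<noteq> {}" using \<open>a \<in> C\<close> by auto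
  then obtain e where "e > 1" "(1 - e) *\<^sub>R a \<in> C"
    using convex_rel_interior_iff[OF \<open>convex C\<close>, of 0] 0 \<open>a \<in> C\<close> by auto
  with nonneg[of "(1 - e) *\<^sub>R a"] have "(1 - e) * (c \<bullet> a) \<ge> 0" by simp
  with \<open>e > 1\<close> have "c \<bullet> a \<le> 0" by (simp add: zero_le_mult_iff)
  with nonneg[OF \<open>a \<in> C\<close>] show ?thesis by simp
qed

text \<open>A vector separating \<open>c\<close> from the cone generated by \<open>G\<close> and the
  orthogonal complement of \<open>L\<close> would lie in \<open>L\<close> and be nonnegative on
  \<open>G\<close>, yet have negative product with \<open>c\<close>.\<close>

lemma Farkas_subspace:
  fixes G :: "'a::euclidean_space set"
  assumes "finite G" "subspace L"
    and nonneg: "\<And>q. q \<in> L \<Longrightarrow> (\<And>g. g \<in> G \<Longrightarrow> 0 \<le> g \<bullet> q) \<Longrightarrow> 0 \<le> c \<bullet> q"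
  obtains d where "d \<in> convex_cone hull G" "\<And>q. q \<in> L \<Longrightarrow> d \<bullet> q = c \<bullet> q"
proof -
  obtain B where B: "finite B" "span B = L\<^sup>\<bottom>"
    using basis_exists[of "L\<^sup>\<bottom>"] subspace_orthogonal_comp[of L]
    by (metis finiteI_independent span_subspace)
  define K where "K = convex_cone hull (G \<union> (B \<union> uminus ` B))"
  have K: "convex_cone K" "closed K"
    using assms(1) B(1) by (simp_all add: K_def convex_cone_convex_cone_hull closed_convex_cone_hull)
  \<comment> \<open>\<open>K\<close> is the sum of the cone generated by \<open>G\<close> and \<open>L\<^sup>\<bottom>\<close>; it is closed because it is
    finitely generated.\<close>
  have "c \<in> K"
  proof (rule ccontr)
    assume "c \<notin> K"
    then obtain a b where ab: "a \<bullet> c < b" "\<And>x. x \<in> K \<Longrightarrow> b < a \<bullet> x"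
      using separating_hyperplane_closed_point[of K c] K by (auto simp: convex_cone_def)
    have "b < 0"
      using ab(2)[of 0] convex_cone_contains_0[OF K(1)] by simp
    \<comment> \<open>A lower bound on a cone improves to 0: a point with negative product could be
      rescaled to product exactly \<open>b\<close>.\<close>
    have ge: "0 \<le> a \<bullet> x" if "x \<in> K" for x
    proof (rule ccontr)
      assume neg: "\<not> 0 \<le> a \<bullet> x"
      have "(b / (a \<bullet> x)) *\<^sub>R x \<in> K"
        using neg \<open>b < 0\<close> by (intro convex_cone_scaleR[OF K(1)] that) (simp add: divide_nonpos_nonpos)
      from ab(2)[OF this] show False using neg by simp
    qed
    have gen: "t \<in> K" if "t \<in> G \<union> (B \<union> uminus ` B)" for t
      using that unfolding K_def by (rule hull_inc)
    \<comment> \<open>Both \<open>t\<close> and \<open>- t\<close> lie in \<open>K\<close>.\<close>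
    have "orthogonal a t" if "t \<in> B" for t
      using ge[OF gen[of t]] ge[OF gen[of "- t"]] that by (auto simp: orthogonal_def)
    then have "orthogonal a t" if "t \<in> span B" for t
      using orthogonal_to_span[OF that] by blast
    then have "a \<in> L\<^sup>\<bottom>\<^sup>\<bottom>"
      unfolding B by (subst orthogonal_comp_def) (auto simp: orthogonal_commute)
    then have "a \<in> L" using orthogonal_comp_self[OF \<open>subspace L\<close>] by simp
    then have "0 \<le> c \<bullet> a"
      using ge gen by (intro nonneg) (auto simp: inner_commute)
    with ab(1) \<open>b < 0\<close> show False by (simp add: inner_commute)
  qed
  then obtain d w where dw: "d \<in> convex_cone hull G" "w \<in> convex_cone hull (B \<union> uminus ` B)"
      "c = d + w"
    unfolding K_def convex_cone_hull_Un[of G] by auto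
  have "convex_cone hull (B \<union> uminus ` B) \<subseteq> span B"
    by (intro hull_minimal subspace_imp_convex_cone subspace_span) (auto intro: span_base span_neg)
  with dw(2) B have "w \<in> L\<^sup>\<bottom>" by auto
  then have "w \<bullet> q = 0" if "q \<in> L" for q
    using that by (auto simp: orthogonal_comp_def orthogonal_def inner_commute)
  with dw show thesis by (intro that[of d]) (auto simp: inner_add_left)
qed

section \<open>Affine majorants by separation\<close>

lemma conic_duality:
  fixes \<Phi> :: "'a \<Rightarrow> 'v::euclidean_space" and E :: "'a \<Rightarrow> real"
  assumes "finite G" and 0: "0 \<in> rel_interior (convex hull (\<Phi> ` X))"
    and le: "\<And>a r. (a, r) \<in> convex hull ((\<lambda>x. (\<Phi> x, E x)) ` X) \<Longrightarrow>
      (\<And>g. g \<in> G \<Longrightarrow> 0 \<le> g \<bullet> a) \<Longrightarrow> r \<le> 1"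
  obtains d where "d \<in> convex_cone hull G" "\<And>x. x \<in> X \<Longrightarrow> E x \<le> 1 - d \<bullet> \<Phi> x"
proof -
  define C where "C = convex hull ((\<lambda>x. (\<Phi> x, E x)) ` X)"
  define A where "A = convex hull (\<Phi> ` X)"
  define L where "L = span (\<Phi> ` X)"
  define Q where "Q = {q \<in> L. \<forall>g\<in>G. 0 \<le> g \<bullet> q}"
  \<comment> \<open>Separating \<open>C\<close> from \<open>Q \<times> {1<..}\<close> becomes
    separating 0 from their difference set; the assumption \<open>le\<close> yields that 0 is
    outside it.\<close>
  define D where "D = (\<Union>x\<in>C. \<Union>y\<in>Q \<times> {1<..}. {x - y})"
  have fstC: "fst ` C = A"
    unfolding C_def A_def
    by (simp add: convex_hull_linear_image[OF linear_fst] image_image)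
  have "A \<subseteq> L"
    unfolding A_def L_def by (simp add: convex_hull_subset_span)
  have DI: "(a - q, r - t) \<in> D" if "(a, r) \<in> C" "q \<in> Q" "t > 1" for a r q t
    using that unfolding D_def by force
  have "0 \<in> Q" by (simp add: Q_def L_def span_zero)
  have scaleQ: "s *\<^sub>R q \<in> Q" if "q \<in> Q" "s \<ge> 0" for s q
    using that by (auto simp: Q_def L_def span_scale)
  have "convex Q"
    by (rule convexI) (auto simp: Q_def L_def span_add span_scale inner_add_right)
  have "convex C" unfolding C_def by simp
  have "0 \<in> A" using 0 rel_interior_subset unfolding A_def by blast
  then obtain r0 where r0: "(0, r0) \<in> C" using fstC by force
  have "convex D"
    unfolding D_def
    by (intro convex_differences \<open>convex C\<close> convex_Times \<open>convex Q\<close>) auto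
  moreover have "D \<noteq> {}" using DI[OF r0 \<open>0 \<in> Q\<close>, of 2] by auto
  moreover have "0 \<notin> D"
  proof
    assume "0 \<in> D"
    then obtain a r q t where "(a, r) \<in> C" "q \<in> Q" "t > 1" "(a, r) = (q, t)"
      unfolding D_def by auto
    with le[of a r] show False by (auto simp: C_def Q_def)
  qed
  \<comment> \<open>A normal vector in \<open>span D\<close> has its first component in
    \<open>L\<close>, which is what later rules out \<open>b = 0\<close>.\<close>
  ultimately obtain cb where cb: "cb \<in> span D" "cb \<noteq> 0" "\<And>x. x \<in> D \<Longrightarrow> 0 \<le> cb \<bullet> x"
    by (rule separating_hyperplane_set_0_inspan) blast
  obtain c b where cb_eq: "cb = (c, b)" by fastforce
  have "D \<subseteq> L \<times> UNIV"
  proof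
    fix z assume "z \<in> D"
    then obtain a r q t where "(a, r) \<in> C" "q \<in> Q" and z: "z = (a - q, r - t)"
      unfolding D_def by auto
    then have "a \<in> L" "q \<in> L" using \<open>A \<subseteq> L\<close> fstC by (force simp: Q_def)+
    then show "z \<in> L \<times> UNIV" by (simp add: z L_def span_diff)
  qed
  then have "span D \<subseteq> L \<times> UNIV"
    by (intro span_minimal subspace_Times) (auto simp: L_def)
  with cb(1) cb_eq have "c \<in> L" by auto
  have sep: "0 \<le> c \<bullet> a - c \<bullet> q + b * (r - t)" if "(a, r) \<in> C" "q \<in> Q" "t > 1" for a r q t
    using cb(3)[OF DI[OF that]] by (simp add: cb_eq inner_diff_right)
  \<comment> \<open>Otherwise a large \<open>t\<close> violates \<open>sep\<close>;
    \<open>\<bar>r0\<bar> + 2\<close> exceeds both 1 and \<open>r0\<close>.\<close>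
  have "b \<le> 0"
  proof (rule ccontr)
    assume "\<not> b \<le> 0"
    then have "b * (r0 - (\<bar>r0\<bar> + 2)) < 0" by (intro mult_pos_neg) auto
    moreover have "1 < \<bar>r0\<bar> + 2" by simp
    ultimately show False using sep[OF r0 \<open>0 \<in> Q\<close>, of "\<bar>r0\<bar> + 2"] by simp
  qed
  \<comment> \<open>In the vertical case \<open>c\<close> is nonnegative on \<open>A\<close>, hence
    zero on \<open>A\<close> and orthogonal to \<open>L\<close>; being in \<open>L\<close>, it
    vanishes.\<close>
  moreover have "b \<noteq> 0"
  proof
    assume "b = 0"
    have "0 \<le> c \<bullet> a" if "a \<in> A" for a
    proof -
      obtain r where "(a, r) \<in> C" using \<open>a \<in> A\<close> fstC by force
      from sep[OF this \<open>0 \<in> Q\<close>, of 2] \<open>b = 0\<close> show ?thesis by simp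
    qed
    then have "c \<bullet> a = 0" if "a \<in> A" for a
      using inner_eq_0_if_0_in_rel_interior[of A c a] 0 that unfolding A_def by blast
    then have "orthogonal c y" if "y \<in> \<Phi> ` X" for y
      using hull_inc[OF that, of convex] unfolding A_def orthogonal_def by blast
    then have "orthogonal c c"
      using orthogonal_to_span[of c "\<Phi> ` X" c] \<open>c \<in> L\<close> unfolding L_def by blast
    then show False using cb(2) cb_eq \<open>b = 0\<close> by (simp add: orthogonal_def zero_prod_def)
  qed
  ultimately have "b < 0" by simp
  \<comment> \<open>\<open>Q\<close> is a cone, so a positive value could be scaled up by
    \<open>s\<close> until it outweighs the fixed term \<open>b * (r0 - 2)\<close>.\<close>
  have cQ: "c \<bullet> q \<le> 0" if "q \<in> Q" for q
  proof (rule ccontr)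
    assume pos: "\<not> c \<bullet> q \<le> 0"
    define s where "s = (\<bar>b * (r0 - 2)\<bar> + 1) / (c \<bullet> q)"
    have "s \<ge> 0" "s * (c \<bullet> q) = \<bar>b * (r0 - 2)\<bar> + 1" using pos by (auto simp: s_def)
    then show False using sep[OF r0 scaleQ[OF \<open>q \<in> Q\<close>], of s 2] by simp
  qed
  \<comment> \<open>Divide \<open>sep\<close> by the negative \<open>b\<close> and let
    \<open>t\<close> decrease to 1.\<close>
  have cX: "E x \<le> 1 - (c \<bullet> \<Phi> x) / b" if "x \<in> X" for x
  proof -
    have mem: "(\<Phi> x, E x) \<in> C" unfolding C_def using that by (intro hull_inc) auto
    have "E x + (c \<bullet> \<Phi> x) / b \<le> t" if "t > 1" for t
    proof -
      have "(c \<bullet> \<Phi> x + b * (E x - t)) / b \<le> 0"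
        using sep[OF mem \<open>0 \<in> Q\<close> that] \<open>b < 0\<close> by (intro divide_nonneg_neg) simp_all
      then show ?thesis using \<open>b < 0\<close> by (simp add: add_divide_distrib)
    qed
    then have "E x + (c \<bullet> \<Phi> x) / b \<le> 1" by (rule dense_ge)
    then show ?thesis by simp
  qed
  have "0 \<le> (c /\<^sub>R b) \<bullet> q" if "q \<in> L" "\<And>g. g \<in> G \<Longrightarrow> 0 \<le> g \<bullet> q" for q
    using cQ[of q] that \<open>b < 0\<close> by (auto simp: Q_def zero_le_mult_iff)
  then obtain d where d: "d \<in> convex_cone hull G" "\<And>q. q \<in> L \<Longrightarrow> d \<bullet> q = (c /\<^sub>R b) \<bullet> q"
    using Farkas_subspace[OF \<open>finite G\<close>, of L "c /\<^sub>R b"] unfolding L_def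
    by (metis subspace_span)
  show thesis
  proof (rule that[OF d(1)])
    fix x assume "x \<in> X"
    then have "d \<bullet> \<Phi> x = (c \<bullet> \<Phi> x) / b"
      using d(2)[of "\<Phi> x"] by (simp add: L_def span_base divide_inverse_commute)
    then show "E x \<le> 1 - d \<bullet> \<Phi> x"
      using cX[OF \<open>x \<in> X\<close>] by simp
  qed
qed

lemma tight_slack_duality:
  fixes \<Phi>' :: "'a \<Rightarrow> real ^ 'k" and \<Phi>'' :: "'a \<Rightarrow> real ^ 'l" and E :: "'a \<Rightarrow> real"
  assumes 0: "0 \<in> rel_interior (convex hull ((\<lambda>x. (\<Phi>' x, \<Phi>'' x)) ` X))"
    and le: "\<And>v r. ((0, v), r) \<in> convex hull ((\<lambda>x. ((\<Phi>' x, \<Phi>'' x), E x)) ` X) \<Longrightarrow>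
      (\<And>i. 0 \<le> v $ i) \<Longrightarrow> r \<le> 1"
  obtains \<mu>' \<mu>'' where "\<And>i. 0 \<le> \<mu>'' $ i" "\<And>x. x \<in> X \<Longrightarrow> E x \<le> 1 - \<mu>' \<bullet> \<Phi>' x - \<mu>'' \<bullet> \<Phi>'' x"
proof -
  \<comment> \<open>Both signs of each tight axis encode an equation as two inequalities; a slack
    axis occurs with positive sign only.\<close>
  define G :: "((real ^ 'k) \<times> (real ^ 'l)) set" where
    "G = range (\<lambda>i. (0, axis i 1)) \<union> (range (\<lambda>j. (axis j 1, 0)) \<union> range (\<lambda>j. (- axis j 1, 0)))"
  have "finite G" by (simp add: G_def)
  have G: "fst a = 0 \<and> (\<forall>i. 0 \<le> snd a $ i)" if "\<And>g. g \<in> G \<Longrightarrow> 0 \<le> g \<bullet> a" for a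
  proof -
    have "0 \<le> snd a $ i" for i
      using that[of "(0, axis i 1)"] by (simp add: G_def inner_prod_def inner_axis')
    moreover have "0 \<le> fst a $ j" "fst a $ j \<le> 0" for j
      using that[of "(axis j 1, 0)"] that[of "(- axis j 1, 0)"]
      by (simp_all add: G_def inner_prod_def inner_axis')
    ultimately show ?thesis by (simp add: vec_eq_iff order_antisym)
  qed
  have "r \<le> 1" if "(a, r) \<in> convex hull ((\<lambda>x. ((\<Phi>' x, \<Phi>'' x), E x)) ` X)"
      "\<And>g. g \<in> G \<Longrightarrow> 0 \<le> g \<bullet> a" for a r
    using le[of "snd a" r] that(1) G[OF that(2)] by (cases a) auto
  then obtain d where d: "d \<in> convex_cone hull G"
      "\<And>x. x \<in> X \<Longrightarrow> E x \<le> 1 - d \<bullet> (\<Phi>' x, \<Phi>'' x)"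
    using conic_duality[OF \<open>finite G\<close> 0, of E] by blast
  have "convex_cone hull G \<subseteq> {d. \<forall>i. 0 \<le> snd d $ i}"
    by (rule hull_minimal) (auto simp: G_def axis_def convex_cone_iff)
  with d show thesis
    by (intro that[of "snd d" "fst d"]) (auto simp: inner_prod_def diff_diff_eq)
qed

section \<open>Finitely supported probability measures\<close>

text \<open>\<open>point_measure\<close> lives on the power set of \<open>S\<close>; the
  push-forward gives it the sigma-algebra that \<open>borel_probs\<close> demands.\<close>

definition discrete_measure ::
  "(real ^ 'n) set \<Rightarrow> (real ^ 'n) set \<Rightarrow> (real ^ 'n \<Rightarrow> real) \<Rightarrow> (real ^ 'n) measure" where
  "discrete_measure X S u = distr (point_measure S u) (restrict_space borel X) (\<lambda>x. x)"

context
  fixes X S :: "(real ^ 'n) set" and u :: "real ^ 'n \<Rightarrow> real"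
  assumes S: "finite S" "S \<subseteq> X" and u: "\<And>x. x \<in> S \<Longrightarrow> 0 \<le> u x"
begin

lemma measurable_id_point_measure:
  "(\<lambda>x. x) \<in> measurable (point_measure S u) (restrict_space borel X)"
  using S(2) by (auto simp: measurable_point_measure_eq1 space_restrict_space)

lemma discrete_measure_in_borel_probs:
  assumes "sum u S = 1"
  shows "discrete_measure X S u \<in> borel_probs X"
proof -
  have "prob_space (point_measure S u)"
    using S u assms by (intro prob_space_point_measure) auto
  then have "prob_space (discrete_measure X S u)"
    unfolding discrete_measure_def using measurable_id_point_measure
    by (rule prob_space.prob_space_distr)
  then show ?thesis by (simp add: borel_probs_def discrete_measure_def)
qed

lemma nn_integral_discrete_measure:
  assumes "f \<in> borel_measurable (restrict_space borel X)" and nonneg: "\<And>x. x \<in> S \<Longrightarrow> 0 \<le> f x"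
  shows "(\<integral>\<^sup>+ x. ennreal (f x) \<partial>discrete_measure X S u) = ennreal (\<Sum>x\<in>S. u x * f x)"
proof -
  have "(\<integral>\<^sup>+ x. ennreal (f x) \<partial>discrete_measure X S u) = (\<Sum>x\<in>S. ennreal (u x) * ennreal (f x))"
    using assms(1) measurable_id_point_measure S(1)
    by (simp add: discrete_measure_def nn_integral_distr nn_integral_point_measure_finite)
  also have "\<dots> = ennreal (\<Sum>x\<in>S. u x * f x)"
    using u nonneg by (simp add: sum_ennreal[symmetric] ennreal_mult)
  finally show ?thesis .
qed

lemma integral_discrete_measure:
  fixes f :: "real ^ 'n \<Rightarrow> 'b::{banach, second_countable_topology}"
  assumes "f \<in> borel_measurable (restrict_space borel X)"
  shows "(\<integral>x. f x \<partial>discrete_measure X S u) = (\<Sum>x\<in>S. u x *\<^sub>R f x)"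
  using assms measurable_id_point_measure S(1) u
  by (simp add: discrete_measure_def integral_distr lebesgue_integral_point_measure_finite)

lemma discrete_measure_in_probs_integrating:
  assumes "sum u S = 1" "continuous_on X \<Psi>"
  shows "discrete_measure X S u \<in> probs_integrating X \<Psi>"
proof -
  have "(\<lambda>x. l1_norm (\<Psi> x)) \<in> borel_measurable (restrict_space borel X)"
    unfolding l1_norm_def
    by (intro borel_measurable_continuous_on_restrict continuous_intros assms)
  then show ?thesis
    using discrete_measure_in_borel_probs[OF assms(1)]
    by (simp add: probs_integrating_def nn_integral_discrete_measure l1_norm_def sum_nonneg)
qed

end

section \<open>The dual class consists of e-variables and is majorising\<close>

text \<open>The l1 norm dominates the Euclidean norm. Integrability is what makes the Bochner
  integrals in the constraints genuine expectations.\<close>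

lemma integrable_if_probs_integrating:
  assumes "continuous_on X \<Psi>" "P \<in> probs_integrating X \<Psi>"
  shows "integrable P \<Psi>"
proof (rule integrableI_bounded)
  have sets: "sets P = sets (restrict_space borel X)"
    using assms(2) by (simp add: probs_integrating_def borel_probs_def)
  show "\<Psi> \<in> borel_measurable P"
    using borel_measurable_continuous_on_restrict[OF assms(1)] measurable_cong_sets[OF sets refl]
    by blast
  have "(\<integral>\<^sup>+ x. norm (\<Psi> x) \<partial>P) \<le> (\<integral>\<^sup>+ x. ennreal (l1_norm (\<Psi> x)) \<partial>P)"
    unfolding l1_norm_def by (intro nn_integral_mono ennreal_leI norm_le_l1_cart)
  also have "\<dots> < \<infinity>" using assms(2) by (simp add: probs_integrating_def)
  finally show "(\<integral>\<^sup>+ x. norm (\<Psi> x) \<partial>P) < \<infinity>" .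
qed

context
  fixes X :: "(real ^ 'n) set"
    and H :: "(real ^ 'n) measure set"
    and \<Phi>' :: "real ^ 'n \<Rightarrow> real ^ 'k"
    and \<Phi>'' :: "real ^ 'n \<Rightarrow> real ^ 'l"
  assumes constr: "loosely_constrained X H \<Phi>' \<Phi>''"
begin

lemma continuous_constraints: "continuous_on X \<Phi>'" "continuous_on X \<Phi>''"
  using constr by (auto simp: loosely_constrained_def)

lemmas measurable_constraints =
  continuous_constraints[THEN borel_measurable_continuous_on_restrict]

text \<open>Under \<open>P\<close> in \<open>H\<close> the tight term has mean 0 and the slack term,
  with its nonnegative multipliers, can only lower the mean below 1.\<close>

lemma dual_e_class_subset: "dual_e_class X \<Phi>' \<Phi>'' \<subseteq> e_variables X H"
proof
  fix E assume "E \<in> dual_e_class X \<Phi>' \<Phi>''"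
  then obtain \<mu>' \<mu>'' where \<mu>: "\<And>i. 0 \<le> \<mu>'' $ i"
      "\<And>x. x \<in> X \<Longrightarrow> 0 \<le> 1 - \<mu>' \<bullet> \<Phi>' x - \<mu>'' \<bullet> \<Phi>'' x"
    and E: "E = restrict (\<lambda>x. 1 - \<mu>' \<bullet> \<Phi>' x - \<mu>'' \<bullet> \<Phi>'' x) X"
    unfolding dual_e_class_def dual_set_def by auto
  let ?e = "\<lambda>x. 1 - \<mu>' \<bullet> \<Phi>' x - \<mu>'' \<bullet> \<Phi>'' x"
  have "E \<in> X \<rightarrow>\<^sub>E {0..}" using \<mu>(2) E by auto
  moreover have "E \<in> borel_measurable (restrict_space borel X)"
  proof (subst measurable_cong)
    show "?e \<in> borel_measurable (restrict_space borel X)"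
      using measurable_constraints by measurable
  qed (simp add: E space_restrict_space)
  moreover have "(\<integral>\<^sup>+ x. ennreal (E x) \<partial>P) \<le> 1" if "P \<in> H" for P
  proof -
    have P: "P \<in> probs_integrating X \<Phi>'" "P \<in> probs_integrating X \<Phi>''"
      "(\<integral>x. \<Phi>' x \<partial>P) = 0" "\<And>i. 0 \<le> (\<integral>x. \<Phi>'' x \<partial>P) $ i"
      using that constr by (auto simp: loosely_constrained_def)
    have int: "integrable P \<Phi>'" "integrable P \<Phi>''"
      using P integrable_if_probs_integrating continuous_constraints by auto
    have "prob_space P" and sets: "sets P = sets (restrict_space borel X)"
      using P(1) by (auto simp: probs_integrating_def borel_probs_def)
    interpret prob_space P by fact
    have space: "space P = X"
      using sets_eq_imp_space_eq[OF sets] by (simp add: space_restrict_space)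
    have "(\<integral>\<^sup>+ x. ennreal (E x) \<partial>P) = (\<integral>\<^sup>+ x. ennreal (?e x) \<partial>P)"
      by (intro nn_integral_cong) (simp add: E space)
    also have "\<dots> = ennreal (\<integral>x. ?e x \<partial>P)"
      using int \<mu>(2) by (intro nn_integral_eq_integral) (auto simp: space)
    also have "(\<integral>x. ?e x \<partial>P) = 1 - \<mu>'' \<bullet> (\<integral>x. \<Phi>'' x \<partial>P)"
      using int P(3) by (simp add: prob_space)
    also have "\<dots> \<le> 1"
      using \<mu>(1) P(4) by (auto simp: inner_vec_def intro!: sum_nonneg)
    finally show ?thesis by (simp add: ennreal_leI)
  qed
  ultimately show "E \<in> e_variables X H" by (simp add: e_variables_def)
qed

text \<open>The weights of the convex combination define a member of \<open>H\<close> under which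
  \<open>r\<close> is the expectation of \<open>E\<close>. This supplies the assumption
  \<open>le\<close> of \<open>tight_slack_duality\<close>.\<close>

lemma e_variable_hull_le_1:
  assumes E: "E \<in> e_variables X H"
    and hull: "((0, v), r) \<in> convex hull ((\<lambda>x. ((\<Phi>' x, \<Phi>'' x), E x)) ` X)"
    and v: "\<And>i. 0 \<le> v $ i"
  shows "r \<le> 1"
proof -
  obtain S u where S: "finite S" "S \<subseteq> X" and u: "\<And>x. x \<in> S \<Longrightarrow> 0 \<le> u x" "sum u S = (1::real)"
    and eq: "(\<Sum>x\<in>S. u x *\<^sub>R ((\<Phi>' x, \<Phi>'' x), E x)) = ((0, v), r)"
    by (rule convex_hull_imageE[OF hull]) blast
  have sums: "(\<Sum>x\<in>S. u x *\<^sub>R \<Phi>' x) = 0" "(\<Sum>x\<in>S. u x *\<^sub>R \<Phi>'' x) = v" "(\<Sum>x\<in>S. u x * E x) = r"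
    using arg_cong[OF eq, of "fst \<circ> fst"] arg_cong[OF eq, of "snd \<circ> fst"] arg_cong[OF eq, of snd]
    by (simp_all add: fst_sum snd_sum)
  let ?P = "discrete_measure X S u"
  have "?P \<in> probs_integrating X \<Phi>'" "?P \<in> probs_integrating X \<Phi>''"
    by (intro discrete_measure_in_probs_integrating S u continuous_constraints; assumption)+
  moreover have "(\<integral>x. \<Phi>' x \<partial>?P) = 0" "(\<integral>x. \<Phi>'' x \<partial>?P) = v"
    using measurable_constraints sums by (simp_all add: integral_discrete_measure[OF S] u(1))
  ultimately have "?P \<in> H"
    using constr v by (simp add: loosely_constrained_def)
  with E have "(\<integral>\<^sup>+ x. ennreal (E x) \<partial>?P) \<le> 1" by (simp add: e_variables_def)
  moreover have "(\<integral>\<^sup>+ x. ennreal (E x) \<partial>?P) = ennreal r"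
    using E S(2) by (subst nn_integral_discrete_measure[OF S]) (auto simp: sums u(1) e_variables_def)
  ultimately show ?thesis by simp
qed

lemma majorising_dual_e_class:
  assumes 0: "0 \<in> rel_interior (convex hull ((\<lambda>x. (\<Phi>' x, \<Phi>'' x)) ` X))"
  shows "majorising X H (dual_e_class X \<Phi>' \<Phi>'')"
  unfolding majorising_def
proof (intro conjI ballI dual_e_class_subset)
  fix E assume E: "E \<in> e_variables X H"
  obtain \<mu>' \<mu>'' where \<mu>: "\<And>i. 0 \<le> \<mu>'' $ i"
      "\<And>x. x \<in> X \<Longrightarrow> E x \<le> 1 - \<mu>' \<bullet> \<Phi>' x - \<mu>'' \<bullet> \<Phi>'' x"
    by (rule tight_slack_duality[OF 0, of E]) (use e_variable_hull_le_1[OF E] in blast)+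
  \<comment> \<open>The majorant inherits nonnegativity from \<open>E\<close>.\<close>
  have "0 \<le> 1 - \<mu>' \<bullet> \<Phi>' x - \<mu>'' \<bullet> \<Phi>'' x" if "x \<in> X" for x
    using E \<mu>(2)[OF that] that by (force simp: e_variables_def)
  then have "(\<mu>', \<mu>'') \<in> dual_set X \<Phi>' \<Phi>''"
    using \<mu>(1) by (simp add: dual_set_def)
  then show "\<exists>E'\<in>dual_e_class X \<Phi>' \<Phi>''. \<forall>x\<in>X. E x \<le> E' x"
    using \<mu>(2) unfolding dual_e_class_def by force
qed

end

section \<open>Maximality and optimality\<close>

lemma dual_e_class_antichain:
  assumes 0: "0 \<in> rel_interior (convex hull ((\<lambda>x. (\<Phi>' x, \<Phi>'' x)) ` X))"
    and E: "E \<in> dual_e_class X \<Phi>' \<Phi>''" and F: "F \<in> dual_e_class X \<Phi>' \<Phi>''"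
    and le: "\<And>x. x \<in> X \<Longrightarrow> E x \<le> F x"
  shows "E = F"
proof -
  let ?\<Phi> = "\<lambda>x. (\<Phi>' x, \<Phi>'' x)"
  \<comment> \<open>Pairing the multipliers makes \<open>F - E\<close> on \<open>X\<close> a single
    linear functional of the joint constraint.\<close>
  obtain \<mu> where \<mu>: "E = restrict (\<lambda>x. 1 - \<mu> \<bullet> ?\<Phi> x) X"
    using E by (auto simp: dual_e_class_def diff_diff_eq inner_Pair[symmetric] simp del: inner_Pair)
  obtain \<nu> where \<nu>: "F = restrict (\<lambda>x. 1 - \<nu> \<bullet> ?\<Phi> x) X"
    using F by (auto simp: dual_e_class_def diff_diff_eq inner_Pair[symmetric] simp del: inner_Pair)
  have "convex hull (?\<Phi> ` X) \<subseteq> {a. 0 \<le> (\<mu> - \<nu>) \<bullet> a}"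
  proof (intro hull_minimal convex_halfspace_ge)
    show "?\<Phi> ` X \<subseteq> {a. 0 \<le> (\<mu> - \<nu>) \<bullet> a}"
      using le by (force simp: \<mu> \<nu> inner_diff_left)
  qed
  then have "(\<mu> - \<nu>) \<bullet> ?\<Phi> x = 0" if "x \<in> X" for x
    using that by (intro inner_eq_0_if_0_in_rel_interior[OF _ 0]) (auto intro: hull_inc)
  then show ?thesis
    unfolding \<mu> \<nu> by (intro restrict_ext) (simp add: inner_diff_left)
qed

theorem proposition6:
  fixes X :: "(real ^ 'n) set"
    and H :: "(real ^ 'n) measure set"
    and \<Phi>' :: "real ^ 'n \<Rightarrow> real ^ 'k"
    and \<Phi>'' :: "real ^ 'n \<Rightarrow> real ^ 'l"
  assumes "closed X"
    and "properly_loosely_constrained X H \<Phi>' \<Phi>''"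
  shows "optimal_e_class X H (dual_e_class X \<Phi>' \<Phi>'')"
proof -
  have constr: "loosely_constrained X H \<Phi>' \<Phi>''"
    and 0: "0 \<in> rel_interior (convex hull ((\<lambda>x. (\<Phi>' x, \<Phi>'' x)) ` X))"
    using assms(2) by (auto simp: properly_loosely_constrained_def)
  let ?D = "dual_e_class X \<Phi>' \<Phi>''"
  have maj: "majorising X H ?D"
    using constr 0 by (rule majorising_dual_e_class)
  have "?D \<subseteq> \<F>" if \<F>: "majorising X H \<F>" for \<F>
  proof
    fix E assume E: "E \<in> ?D"
    with maj have "E \<in> e_variables X H" by (auto simp: majorising_def)
    then obtain E' where E': "E' \<in> \<F>" "\<And>x. x \<in> X \<Longrightarrow> E x \<le> E' x"
      using \<F> by (auto simp: majorising_def)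
    then have var: "E' \<in> e_variables X H" using \<F> by (auto simp: majorising_def)
    then obtain F where F: "F \<in> ?D" "\<And>x. x \<in> X \<Longrightarrow> E' x \<le> F x"
      using maj by (auto simp: majorising_def)
    \<comment> \<open>\<open>E'\<close> is squeezed between two members of the antichain
      \<open>?D\<close>.\<close>
    have "E = F"
      using 0 E F(1) E'(2) F(2) by (rule dual_e_class_antichain[OF _ _ _ order_trans])
    have "E' = E"
    \<comment> \<open>Both functions are \<open>undefined\<close> outside \<open>X\<close>, so
      agreement on \<open>X\<close> suffices.\<close>
    proof (rule extensionalityI[of _ X])
      show "E' \<in> extensional X" "E \<in> extensional X"
        using var \<open>E \<in> e_variables X H\<close> by (auto simp: e_variables_def PiE_def)
      show "E' x = E x" if "x \<in> X" for x
        using E'(2)[OF that] F(2)[OF that] \<open>E = F\<close> by simp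
    qed
    with E'(1) show "E \<in> \<F>" by simp
  qed
  with maj show ?thesis by (simp add: optimal_e_class_def)
qed

end
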